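(* Consider the centralized mechanism and the induced game $\mathcal{G}$ described in the context. If (pure-strategy) Nash equilibria of $\mathcal{G}$ exist, then every Nash equilibrium $m^*$ results in the same allocation as the optimal solution of the centralized problem: $\hat{\boldsymbol{x}}(m^* )=\boldsymbol{x}^*$, where $(\boldsymbol{x}^*,w^* )$ is the optimal solution of $$\max_{\boldsymbol{x}\in\mathbb{R}^{NT},\,w\in\mathbb{R}}\ \sum_{i=1}^N v^i(\boldsymbol{x}^i)-\sum_{t=1}^T p_t\sum_{i=1}^N x^i_t-p_0w\quad\text{subject to}\quad A\boldsymbol{x}\le\boldsymbol{b},\quad \sum_{i=1}^N x^i_t\le w\ \ (t=1,\dots,T).$$
   Context: Setting. There are $N\ge 2$ users $\mathcal{N}=\{1,\dots,N\}$ (user indices $i\pm1$ are taken modulo $N$) and $T\ge 1$ time slots. The prices $p_1,\dots,p_T\in\mathbb{R}$ and the peak price $p_0\ge 0$ are fixed. User $i$'s demand vector is $\boldsymbol{x}^i=(x^i_1,\dots,x^i_T)\in\mathbb{R}^T$, and $\boldsymbol{x}=(\boldsymbol{x}^1,\dots,\boldsymbol{x}^N)\in\mathbb{R}^{NT}$. User $i$'s utility is $v^i(\boldsymbol{x}^i)=\sum_{t=1}^T v^i_t(x^i_t)$, where each $v^i_t:\mathbb{R}\to\mathbb{R}$ is twice differentiable and strictly concave. The feasible set $\mathcal{X}=\{\boldsymbol{x}: A\boldsymbol{x}\le\boldsymbol{b}\}$, with $A\in\mathbb{R}^{L\times NT}$ and $\boldsymbol{b}=(b^1,\dots,b^L)\in\mathbb{R}^L_+$,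 is a (bounded) polytope and is coordinate convex: if $\boldsymbol{x}\in\mathcal{X}$, then setting any components of $\boldsymbol{x}$ to $0$ gives a point of $\mathcal{X}$. Row $l$ of $A$ has entries $a^{i,l}_t$; put $\boldsymbol{a}^{i,l}=[a^{i,l}_1,\dots,a^{i,l}_T]$ (row vector), so constraint $l$ is $\sum_i\boldsymbol{a}^{i,l}\boldsymbol{x}^i\le b^l$. Let $\mathcal{L}=\{1,\dots,L\}$ and $\mathcal{L}_i=\{l\in\mathcal{L}:\boldsymbol{a}^{i,l}\ne 0\}$. Centralized mechanism. User $i$'s message is $m^i=((y^i_t)_{t},(q^{i,l})_{l\in\mathcal{L}},(s^i_t)_{t},(\beta^i_t)_{t})$ with $y^i_t\in\mathbb{R}$, $q^{i,l}\in\mathbb{R}_+$, $s^i_t\in\mathbb{R}_+$, $\beta^i_t\in\mathbb{R}$; $m=(m^1,\dots,m^N)$. The allocation is $\hat x^i_t(m)=y^i_t$. The radial pricing operator is, for $\tilde{\boldsymbol{s}}\in\mathbb{R}^T_+$, $\tilde{\boldsymbol{y}}\in\mathbb{R}^T$, $$\mathcal{RP}^i_t(\tilde{\boldsymbol{s}},\tilde{\boldsymbol{y}})=\begin{cases}\dfrac{\tilde s_t}{\sum_{t'}\tilde s_{t'}}\,p_0,&\tilde{\boldsymbol{s}}\neq\boldsymbol{0},\\[2mm] \dfrac{p_0\,\mathbf{1}\{t\in\arg\max_{t'}\tilde y_{t'}\}}{\#(\arg\max_{t'}\tilde y_{t'})},&\tilde{\boldsymbol{s}}=\boldsymbol{0}\end{cases}$$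 (the same formula for every $i$). Define $s^{-i}_t=\frac1{N-1}\sum_{j\ne i}s^j_t$, $q^{-i,l}=\frac1{N-1}\sum_{j\ne i}q^{j,l}$, $\zeta^{-i}_t=\sum_{j\neq i}y^j_t+\beta^{i-1}_t$, $z^{-i}=\max_t\zeta^{-i}_t$, with vectors $\boldsymbol{s}^{-i}=(s^{-i}_t)_t$, $\boldsymbol{\zeta}^{-i}=(\zeta^{-i}_t)_t$. The tax of user $i$ is $$\hat t^i(m)=\sum_{t=1}^T\big(p_t+\mathcal{RP}^i_t(\boldsymbol{s}^{-i},\boldsymbol{\zeta}^{-i})\big)\hat x^i_t(m)+\sum_{l\in\mathcal{L}_i}q^{-i,l}\boldsymbol{a}^{i,l}\hat{\boldsymbol{x}}^i(m)+\sum_{t=1}^T(\beta^i_t-y^{i+1}_t)^2$$ $$+\sum_{l\in\mathcal{L}}\Big[(q^{i,l}-q^{-i,l})^2+q^{i,l}\Big(b^l-\sum_{j\ne i}\boldsymbol{a}^{j,l}\boldsymbol{y}^j-\boldsymbol{a}^{i,l}\boldsymbol{\beta}^{i-1}\Big)\Big]+\sum_{t=1}^T\Big[(s^i_t-s^{-i}_t)^2+s^i_t(z^{-i}-\zeta^{-i}_t)\Big].$$ The induced game $\mathcal{G}$ has players $\mathcal{N}$, strategies $m^i$, and payoffs $u^i(m)=v^i(\hat{\boldsymbol{x}}^i(m))-\hat t^i(m)$. Nash equilibrium (NE) means pure-strategy Nash equilibrium. *)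

theory Defs
  imports "HOL-Analysis.Analysis"
begin

text \<open>
  Users, time slots and linear constraints are indexed by the finite types \<open>'n\<close>, \<open>'t\<close>, \<open>'l\<close>, so
  \<open>N = CARD('n)\<close>, \<open>T = CARD('t)\<close>, \<open>L = CARD('l)\<close>.  A demand profile is \<open>x :: real^'t^'n\<close> with
  \<open>x $ i $ t\<close> the demand of user \<open>i\<close> in slot \<open>t\<close>.  The constraint matrix is \<open>A :: real^'t^'n^'l\<close>,
  where \<open>A $ l $ i\<close> is the block of row \<open>l\<close> that belongs to user \<open>i\<close>.
\<close>

subsection \<open>The environment\<close>

definition twice_differentiable :: "(real \<Rightarrow> real) \<Rightarrow> bool" where
  "twice_differentiable f \<longleftrightarrow>
     (\<forall>z. f differentiable (at z)) \<and> (\<forall>z. deriv f differentiable (at z))"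

definition strictly_concave :: "(real \<Rightarrow> real) \<Rightarrow> bool" where
  "strictly_concave f \<longleftrightarrow>
     (\<forall>x y u. x \<noteq> y \<longrightarrow> 0 < u \<longrightarrow> u < 1 \<longrightarrow>
        u * f x + (1 - u) * f y < f (u * x + (1 - u) * y))"

definition feasible_set :: "real^'t^'n^'l \<Rightarrow> real^'l \<Rightarrow> (real^'t^'n) set" where
  "feasible_set A b = {x. \<forall>l. (\<Sum>i\<in>UNIV. (A $ l $ i) \<bullet> (x $ i)) \<le> b $ l}"

definition coordinate_convex :: "(real^'t^'n) set \<Rightarrow> bool" where
  "coordinate_convex X \<longleftrightarrow>
     (\<forall>x\<in>X. \<forall>Z :: ('n \<times> 't) set.
        (\<chi> i t. if (i, t) \<in> Z then 0 else x $ i $ t) \<in> X)"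

definition utility :: "('n \<Rightarrow> 't \<Rightarrow> real \<Rightarrow> real) \<Rightarrow> 'n \<Rightarrow> real^'t \<Rightarrow> real" where
  "utility v i d = (\<Sum>t\<in>UNIV. v i t (d $ t))"

subsection \<open>The centralized problem\<close>

definition centralized_objective ::
  "('n \<Rightarrow> 't \<Rightarrow> real \<Rightarrow> real) \<Rightarrow> real^'t \<Rightarrow> real \<Rightarrow> (real^'t^'n) \<times> real \<Rightarrow> real" where
  "centralized_objective v p p0 = (\<lambda>(x, w).
     (\<Sum>i\<in>UNIV. utility v i (x $ i)) - (\<Sum>t\<in>UNIV. p $ t * (\<Sum>i\<in>UNIV. x $ i $ t)) - p0 * w)"

definition centralized_feasible ::
  "real^'t^'n^'l \<Rightarrow> real^'l \<Rightarrow> (real^'t^'n) \<times> real \<Rightarrow> bool" where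
  "centralized_feasible A b = (\<lambda>(x, w).
     x \<in> feasible_set A b \<and> (\<forall>t. (\<Sum>i\<in>UNIV. x $ i $ t) \<le> w))"

definition centralized_optimal ::
  "('n \<Rightarrow> 't \<Rightarrow> real \<Rightarrow> real) \<Rightarrow> real^'t \<Rightarrow> real \<Rightarrow> real^'t^'n^'l \<Rightarrow> real^'l \<Rightarrow>
   (real^'t^'n) \<times> real \<Rightarrow> bool" where
  "centralized_optimal v p p0 A b =
     is_arg_max (centralized_objective v p p0) (centralized_feasible A b)"

subsection \<open>The mechanism\<close>

text \<open>
  A message \<open>(y, q, s, \<beta>)\<close>: own demand, suggested constraint prices, suggested peak prices, and
  a guess of the next user's demand.
\<close>

record ('t, 'l) message =
  msg_y :: "real^'t"
  msg_q :: "real^'l"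
  msg_s :: "real^'t"
  msg_beta :: "real^'t"

definition message_space :: "('t::finite, 'l::finite) message set" where
  "message_space = {mi. (\<forall>l. 0 \<le> msg_q mi $ l) \<and> (\<forall>t. 0 \<le> msg_s mi $ t)}"

text \<open>
  The cyclic order of the users is given by a numbering \<open>num :: 'n \<Rightarrow> nat\<close>, a bijection onto
  \<open>{..<CARD('n)}\<close>; numbering from 0 instead of 1 does not affect the cyclic order.
\<close>

definition next_user :: "('n::finite \<Rightarrow> nat) \<Rightarrow> 'n \<Rightarrow> 'n" where
  "next_user num i = inv num ((num i + 1) mod CARD('n))"

definition prev_user :: "('n::finite \<Rightarrow> nat) \<Rightarrow> 'n \<Rightarrow> 'n" where
  "prev_user num i = inv num ((num i + CARD('n) - 1) mod CARD('n))"

definition allocation :: "('n \<Rightarrow> ('t::finite, 'l::finite) message) \<Rightarrow> real^'t^'n" where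
  "allocation m = (\<chi> i. msg_y (m i))"

definition peak_slots :: "real^'t \<Rightarrow> 't set" where
  "peak_slots y = {t. is_arg_max (($) y) (\<lambda>_. True) t}"

definition radial_price :: "real \<Rightarrow> real^'t \<Rightarrow> real^'t \<Rightarrow> 't \<Rightarrow> real" where
  "radial_price p0 s y t =
     (if s \<noteq> 0 then s $ t / (\<Sum>t'\<in>UNIV. s $ t') * p0
      else p0 * of_bool (t \<in> peak_slots y) / real (card (peak_slots y)))"

definition others_mean :: "('n::finite \<Rightarrow> real^'k) \<Rightarrow> 'n \<Rightarrow> real^'k" where
  "others_mean f i = (1 / (real CARD('n) - 1)) *\<^sub>R (\<Sum>j\<in>UNIV - {i}. f j)"

definition s_others :: "('n::finite \<Rightarrow> ('t::finite, 'l::finite) message) \<Rightarrow> 'n \<Rightarrow> real^'t" where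
  "s_others m = others_mean (\<lambda>j. msg_s (m j))"

definition q_others :: "('n::finite \<Rightarrow> ('t::finite, 'l::finite) message) \<Rightarrow> 'n \<Rightarrow> real^'l" where
  "q_others m = others_mean (\<lambda>j. msg_q (m j))"

definition zeta ::
  "('n::finite \<Rightarrow> nat) \<Rightarrow> ('n \<Rightarrow> ('t::finite, 'l::finite) message) \<Rightarrow> 'n \<Rightarrow> real^'t" where
  "zeta num m i = (\<Sum>j\<in>UNIV - {i}. msg_y (m j)) + msg_beta (m (prev_user num i))"

definition zeta_peak ::
  "('n::finite \<Rightarrow> nat) \<Rightarrow> ('n \<Rightarrow> ('t::finite, 'l::finite) message) \<Rightarrow> 'n \<Rightarrow> real" where
  "zeta_peak num m i = Max (range (\<lambda>t. zeta num m i $ t))"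

definition tax ::
  "('n::finite \<Rightarrow> nat) \<Rightarrow> real^'t \<Rightarrow> real \<Rightarrow> real^'t^'n^'l \<Rightarrow> real^'l \<Rightarrow>
   ('n \<Rightarrow> ('t::finite, 'l::finite) message) \<Rightarrow> 'n \<Rightarrow> real" where
  "tax num p p0 A b m i =
     (\<Sum>t\<in>UNIV. (p $ t + radial_price p0 (s_others m i) (zeta num m i) t) * allocation m $ i $ t)
   + (\<Sum>l\<in>{l. A $ l $ i \<noteq> 0}. q_others m i $ l * ((A $ l $ i) \<bullet> (allocation m $ i)))
   + (\<Sum>t\<in>UNIV. (msg_beta (m i) $ t - msg_y (m (next_user num i)) $ t)\<^sup>2)
   + (\<Sum>l\<in>UNIV. (msg_q (m i) $ l - q_others m i $ l)\<^sup>2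
        + msg_q (m i) $ l *
          (b $ l - (\<Sum>j\<in>UNIV - {i}. (A $ l $ j) \<bullet> msg_y (m j))
             - (A $ l $ i) \<bullet> msg_beta (m (prev_user num i))))
   + (\<Sum>t\<in>UNIV. (msg_s (m i) $ t - s_others m i $ t)\<^sup>2
        + msg_s (m i) $ t * (zeta_peak num m i - zeta num m i $ t))"

definition payoff ::
  "('n::finite \<Rightarrow> nat) \<Rightarrow> ('n \<Rightarrow> 't \<Rightarrow> real \<Rightarrow> real) \<Rightarrow> real^'t \<Rightarrow> real \<Rightarrow>
   real^'t^'n^'l \<Rightarrow> real^'l \<Rightarrow> ('n \<Rightarrow> ('t::finite, 'l::finite) message) \<Rightarrow> 'n \<Rightarrow> real" where
  "payoff num v p p0 A b m i = utility v i (allocation m $ i) - tax num p p0 A b m i"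

definition nash_equilibrium ::
  "('n::finite \<Rightarrow> nat) \<Rightarrow> ('n \<Rightarrow> 't \<Rightarrow> real \<Rightarrow> real) \<Rightarrow> real^'t \<Rightarrow> real \<Rightarrow>
   real^'t^'n^'l \<Rightarrow> real^'l \<Rightarrow> ('n \<Rightarrow> ('t::finite, 'l::finite) message) \<Rightarrow> bool" where
  "nash_equilibrium num v p p0 A b m \<longleftrightarrow>
     (\<forall>i. m i \<in> message_space) \<and>
     (\<forall>i. \<forall>mi\<in>message_space.
        payoff num v p p0 A b (m(i := mi)) i \<le> payoff num v p p0 A b m i)"

end

theory Submission
  imports Defs
begin

text \<open>
  At an equilibrium \<open>\<beta>\<^sup>i = y\<^sup>i\<^sup>+\<^sup>1\<close>, so \<open>\<zeta>\<^sup>-\<^sup>i\<close> is the total demand.  The quadratic penalties,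
  summed over the users, force consensus on the prices \<open>q\<close> and \<open>s\<close>; the linear penalty terms then
  yield feasibility and complementary slackness.  The radial prices split \<open>p\<^sub>0\<close> among the peak
  slots, so all dual conditions of the centralized problem hold, and each user's demand maximizes
  that user's share of the Lagrangian globally.  Weak duality gives optimality, and strict concavity
  of the Lagrangian gives uniqueness.
\<close>

subsection \<open>Single-coordinate arguments\<close>

text \<open>Deviations in \<open>q\<close>, \<open>s\<close> and \<open>y\<close> change one
  coordinate of one block. As the payoff is separable, comparing payoffs then reduces to a single
  summand.\<close>

lemma sum_update_coordinate:
  fixes F :: "'k::finite \<Rightarrow> real \<Rightarrow> real"
  shows "(\<Sum>k\<in>UNIV. F k ((\<chi> k. if k = l then c else x $ k) $ k))
       = (\<Sum>k\<in>UNIV. F k (x $ k)) - F l (x $ l) + F l c"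
proof -
  have "(\<Sum>k\<in>UNIV. F k ((\<chi> k. if k = l then c else x $ k) $ k))
      = F l c + (\<Sum>k\<in>UNIV - {l}. F k ((\<chi> k. if k = l then c else x $ k) $ k))"
    by (subst sum.remove[of _ l]) auto
  also have "(\<Sum>k\<in>UNIV - {l}. F k ((\<chi> k. if k = l then c else x $ k) $ k))
      = (\<Sum>k\<in>UNIV - {l}. F k (x $ k))"
    by (intro sum.cong) auto
  also have "\<dots> = (\<Sum>k\<in>UNIV. F k (x $ k)) - F l (x $ l)"
    by (simp add: sum_diff1)
  finally show ?thesis by simp
qed

text \<open>The midpoint of \<open>x\<close> and \<open>y\<close> has a value above the average of
  the two values but not above the value at \<open>y\<close>, so the value at \<open>x\<close> must
  be the smaller one.\<close>

lemma strictly_concave_strict_max: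
  assumes "strictly_concave f" and max: "\<And>c. f c - k * c \<le> f y - k * y" and "x \<noteq> y"
  shows "f x - k * x < f y - k * y"
proof -
  have "1/2 * f x + (1 - 1/2) * f y < f (1/2 * x + (1 - 1/2) * y)"
    using assms(1)[unfolded strictly_concave_def, rule_format, of x y "1/2"] assms(3) by simp
  moreover have "f (1/2 * x + (1 - 1/2) * y) - k * (1/2 * x + (1 - 1/2) * y) \<le> f y - k * y"
    by (rule max)
  ultimately show ?thesis by (simp add: algebra_simps)
qed

lemma others_mean_nth:
  "others_mean f i $ k = (\<Sum>j\<in>UNIV - {i}. f j $ k) / (real CARD('n) - 1)"
  for f :: "'n::finite \<Rightarrow> real^'k"
  by (simp add: others_mean_def)

text \<open>
  Comparing \<open>f i\<close> with the mean \<open>M i\<close> of the others gives \<open>(f i - M i)\<^sup>2 + (f i - M i) * g \<le> 0\<close>,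
  and the linear parts cancel in the sum over \<open>i\<close>.
\<close>

lemma penalty_consensus:
  fixes f :: "'n::finite \<Rightarrow> real^'k"
  assumes N: "CARD('n) \<ge> 2"
    and nonneg: "\<And>i. 0 \<le> f i $ k"
    and opt: "\<And>i c. 0 \<le> c \<Longrightarrow> (f i $ k - others_mean f i $ k)\<^sup>2 + f i $ k * g
                  \<le> (c - others_mean f i $ k)\<^sup>2 + c * g"
  shows "others_mean f i $ k = f i $ k" and "f i $ k = f j $ k"
    and "0 \<le> g" and "f i $ k * g = 0"
proof -
  define S where "S = (\<Sum>j\<in>UNIV. f j $ k)"
  define M where "M i = others_mean f i $ k" for i
  have N1: "real CARD('n) - 1 > 0" using N by linarith
  have M: "M i = (S - f i $ k) / (real CARD('n) - 1)" for i
    by (simp add: M_def others_mean_nth S_def sum_diff1)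
  have M0: "0 \<le> M i" for i
    unfolding M_def others_mean_nth using N1 nonneg by (intro divide_nonneg_pos sum_nonneg) auto
  \<comment> \<open>Each \<open>f j\<close> occurs in the means of the other N - 1 users, with
    weight 1 / (N - 1).\<close>
  have "(\<Sum>i\<in>UNIV. M i) = S"
    using N1 by (simp add: M S_def flip: sum_divide_distrib)
      (simp add: sum_subtractf field_simps)
  then have sum0: "(\<Sum>i\<in>UNIV. f i $ k - M i) = 0"
    by (simp add: sum_subtractf S_def)
  have "(f i $ k - M i)\<^sup>2 + (f i $ k - M i) * g \<le> 0" for i
    using opt[OF M0, of i i] by (simp add: M_def algebra_simps)
  then have "(\<Sum>i\<in>UNIV. (f i $ k - M i)\<^sup>2 + (f i $ k - M i) * g) \<le> 0"
    by (intro sum_nonpos) auto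
  then have "(\<Sum>i\<in>UNIV. (f i $ k - M i)\<^sup>2) \<le> 0"
    by (simp add: sum.distrib sum0 flip: sum_distrib_right)
  then have "(\<Sum>i\<in>UNIV. (f i $ k - M i)\<^sup>2) = 0"
    by (simp add: antisym sum_nonneg)
  then have eq: "f i $ k = M i" for i
    by (simp add: sum_nonneg_eq_0_iff)
  then show "others_mean f i $ k = f i $ k" by (simp add: M_def)
  have "f i $ k = S / real CARD('n)" for i
    using eq[of i] N1 by (simp add: M field_simps)
  then show "f i $ k = f j $ k" by simp
  have opt': "f i $ k * g \<le> (c - f i $ k)\<^sup>2 + c * g" if "0 \<le> c" for c
    using opt[OF that, of i] eq[of i] by (simp add: M_def)
  show g: "0 \<le> g"
  proof (rule ccontr)
    assume "\<not> 0 \<le> g"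
    then have "g * g > 0" by (simp add: mult_neg_neg)
    \<comment> \<open>The unconstrained minimizer in \<open>c\<close> is
      \<open>f i $ k - g/2\<close>, which is admissible because \<open>g\<close> is negative
      here.\<close>
    moreover have "f i $ k * g \<le> (g/2)\<^sup>2 + (f i $ k - g/2) * g"
      using opt'[of "f i $ k - g/2"] nonneg[of i] \<open>\<not> 0 \<le> g\<close> by simp
    ultimately show False by (simp add: power2_eq_square algebra_simps)
  qed
  show "f i $ k * g = 0"
  proof (rule ccontr)
    assume "f i $ k * g \<noteq> 0"
    with g nonneg[of i] have pos: "g > 0" "f i $ k > 0"
      by (auto simp: less_eq_real_def)
    \<comment> \<open>A step from \<open>f i $ k\<close> towards the minimizer
      \<open>f i $ k - g/2\<close>, cut off so that \<open>c\<close> stays nonnegative.\<close>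
    define e where "e = min (f i $ k) (g/2)"
    have e: "0 < e" "e \<le> f i $ k" "e < g" using pos by (auto simp: e_def)
    have "f i $ k * g \<le> e\<^sup>2 + (f i $ k - e) * g"
      using opt'[of "f i $ k - e"] e by simp
    then have "e * g \<le> e * e" by (simp add: power2_eq_square algebra_simps)
    with e show False by simp
  qed
qed

text \<open>Complementarity confines a nonzero \<open>s\<close> to the peak slots of
  \<open>y\<close>; for \<open>s = 0\<close> the uniform split over these slots does the same.
  Either way the prices form a multiplier of total \<open>p0\<close> for the peak
  constraints.\<close>

lemma radial_price_peak:
  assumes s: "\<And>t. 0 \<le> s $ t" and comp: "\<And>t. s $ t * (Max (range (($) y)) - y $ t) = 0"
    and "p0 \<ge> 0"
  shows "0 \<le> radial_price p0 s y t"
    and "(\<Sum>t\<in>UNIV. radial_price p0 s y t) = p0"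
    and "radial_price p0 s y t * (Max (range (($) y)) - y $ t) = 0"
proof -
  have pk: "t \<in> peak_slots y \<longleftrightarrow> y $ t = Max (range (($) y))" for t
    by (auto simp: peak_slots_def is_arg_max_linorder intro!: antisym Max.boundedI Max_ge)
  \<comment> \<open>The maximum is attained, so the number of peak slots is a legitimate
    divisor.\<close>
  have "Max (range (($) y)) \<in> range (($) y)" by (intro Max_in) auto
  then obtain u where "u \<in> peak_slots y" using pk by force
  then have card: "card (peak_slots y) \<noteq> 0" by auto
  have S: "(\<Sum>t\<in>UNIV. s $ t) \<noteq> 0" if "s \<noteq> 0"
    using that s by (auto simp: sum_nonneg_eq_0_iff vec_eq_iff)
  have S0: "(\<Sum>t\<in>UNIV. s $ t) \<ge> 0" using s by (simp add: sum_nonneg)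
  show "0 \<le> radial_price p0 s y t"
    using S0 s assms(3) by (simp add: radial_price_def)
  show "(\<Sum>t\<in>UNIV. radial_price p0 s y t) = p0"
  proof (cases "s = 0")
    case True
    then show ?thesis using card
      by (simp add: radial_price_def flip: sum_divide_distrib sum_distrib_left)
  next
    case False
    then show ?thesis using S
      by (simp add: radial_price_def flip: sum_divide_distrib sum_distrib_right)
  qed
  show "radial_price p0 s y t * (Max (range (($) y)) - y $ t) = 0"
    using comp[of t] pk[of t] by (auto simp: radial_price_def)
qed

subsection \<open>Unilateral deviations\<close>

text \<open>With at least two users, both neighbours are other users, so the guess used in
  \<open>zeta\<close> and the target of the \<open>\<beta>\<close> penalty are beyond the control of
  \<open>i\<close>.\<close>

lemma next_prev_user:
  fixes num :: "'n::finite \<Rightarrow> nat"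
  assumes "CARD('n) \<ge> 2" "bij_betw num UNIV {..<CARD('n)}"
  shows "next_user num (prev_user num i) = i" and "prev_user num i \<noteq> i"
    and "next_user num i \<noteq> i"
proof -
  let ?N = "CARD('n)"
  have inj: "inj num" and surj: "range num = {..<?N}"
    using assms(2) by (auto simp: bij_betw_def)
  have lt: "num i < ?N" using surj by auto
  have num_inv: "num (inv num k) = k" if "k < ?N" for k
    using surj that by (simp add: f_inv_into_f)
  have prev: "num (prev_user num i) = (num i + ?N - 1) mod ?N"
    using num_inv by (simp add: prev_user_def)
  have "num (next_user num (prev_user num i)) = ((num i + ?N - 1) mod ?N + 1) mod ?N"
    using num_inv by (simp add: next_user_def prev)
  also have "\<dots> = (num i + ?N - 1 + 1) mod ?N" by (rule mod_add_left_eq)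
  also have "\<dots> = num i" using lt assms(1) by simp
  finally show "next_user num (prev_user num i) = i" using inj by (simp add: inj_eq)
  have nxt: "num (next_user num i) = (num i + 1) mod ?N"
    using num_inv by (simp add: next_user_def)
  then have "num (next_user num i) \<noteq> num i"
    using lt assms(1) by (cases "num i + 1 = ?N") auto
  then show "next_user num i \<noteq> i" by auto
  have "num (prev_user num i) \<noteq> num i"
  proof (cases "num i")
    \<comment> \<open>Number 0 wraps around to N - 1, which is nonzero since N is at least
      2.\<close>
    case 0
    then show ?thesis using prev assms(1) by simp
  next
    case (Suc k)
    then have "num (prev_user num i) = k" using prev lt by simp
    with Suc show ?thesis by simp
  qed
  then show "prev_user num i \<noteq> i" by auto
qed

text \<open>The coefficient of the user's own demand in the tax, a price that \<open>i\<close> takes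
  as given.\<close>

definition unit_price ::
  "('n::finite \<Rightarrow> nat) \<Rightarrow> real^'t \<Rightarrow> real \<Rightarrow> real^'t^'n^'l \<Rightarrow>
   ('n \<Rightarrow> ('t::finite, 'l::finite) message) \<Rightarrow> 'n \<Rightarrow> 't \<Rightarrow> real" where
  "unit_price num p p0 A m i t =
     p $ t + radial_price p0 (s_others m i) (zeta num m i) t
     + (\<Sum>l\<in>UNIV. q_others m i $ l * A $ l $ i $ t)"

text \<open>The factors of the linear terms and the targets of the quadratic penalties do not
  involve \<open>mi\<close>. Hence the payoff splits into separate blocks for \<open>y\<close>,
  \<open>\<beta>\<close>, \<open>q\<close> and \<open>s\<close>, which can be varied one at a
  time.\<close>

lemma payoff_update:
  fixes m :: "'n::finite \<Rightarrow> ('t::finite, 'l::finite) message"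
  assumes "CARD('n) \<ge> 2" "bij_betw num UNIV {..<CARD('n)}"
  shows "payoff num v p p0 A b (m(i := mi)) i =
    (\<Sum>t\<in>UNIV. v i t (msg_y mi $ t) - unit_price num p p0 A m i t * msg_y mi $ t)
    - (\<Sum>t\<in>UNIV. (msg_beta mi $ t - msg_y (m (next_user num i)) $ t)\<^sup>2)
    - (\<Sum>l\<in>UNIV. (msg_q mi $ l - q_others m i $ l)\<^sup>2
        + msg_q mi $ l *
          (b $ l - (\<Sum>j\<in>UNIV - {i}. (A $ l $ j) \<bullet> msg_y (m j))
             - (A $ l $ i) \<bullet> msg_beta (m (prev_user num i))))
    - (\<Sum>t\<in>UNIV. (msg_s mi $ t - s_others m i $ t)\<^sup>2
        + msg_s mi $ t * (zeta_peak num m i - zeta num m i $ t))"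
proof -
  note pn = next_prev_user[OF assms]
  have mean: "others_mean (\<lambda>j. g ((m(i := mi)) j)) i = others_mean (\<lambda>j. g (m j)) i"
    for g :: "('t, 'l) message \<Rightarrow> real^'k"
    unfolding others_mean_def by (intro arg_cong[where f = "scaleR _"] sum.cong) auto
  have s: "s_others (m(i := mi)) i = s_others m i" unfolding s_others_def by (rule mean)
  have q: "q_others (m(i := mi)) i = q_others m i" unfolding q_others_def by (rule mean)
  have z: "zeta num (m(i := mi)) i = zeta num m i"
    using pn(2)[of i] unfolding zeta_def by (intro arg_cong2[where f = "(+)"] sum.cong) auto
  have zp: "zeta_peak num (m(i := mi)) i = zeta_peak num m i"
    unfolding zeta_peak_def z ..
  have others: "(\<Sum>j\<in>UNIV - {i}. (A $ l $ j) \<bullet> msg_y ((m(i := mi)) j))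
      = (\<Sum>j\<in>UNIV - {i}. (A $ l $ j) \<bullet> msg_y (m j))" for l
    by (intro sum.cong) auto
  have prev: "(m(i := mi)) (prev_user num i) = m (prev_user num i)"
    and nxt: "(m(i := mi)) (next_user num i) = m (next_user num i)"
    and own: "(m(i := mi)) i = mi" "allocation (m(i := mi)) $ i = msg_y mi"
    using pn by (auto simp: allocation_def)
  \<comment> \<open>Rows that do not involve \<open>i\<close> contribute zero, so the sum may run
    over all \<open>l\<close>, as in \<open>unit_price\<close>.\<close>
  have "(\<Sum>l\<in>{l. A $ l $ i \<noteq> 0}. q_others m i $ l * ((A $ l $ i) \<bullet> msg_y mi))
      = (\<Sum>l\<in>UNIV. q_others m i $ l * ((A $ l $ i) \<bullet> msg_y mi))"
    by (intro sum.mono_neutral_left) auto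
  also have "\<dots> = (\<Sum>l\<in>UNIV. \<Sum>t\<in>UNIV. q_others m i $ l * A $ l $ i $ t * msg_y mi $ t)"
    by (simp add: inner_vec_def sum_distrib_left mult.assoc)
  also have "\<dots> = (\<Sum>t\<in>UNIV. (\<Sum>l\<in>UNIV. q_others m i $ l * A $ l $ i $ t) * msg_y mi $ t)"
    by (subst sum.swap) (simp add: sum_distrib_right)
  finally show ?thesis
    unfolding payoff_def tax_def s q z zp others prev nxt own utility_def unit_price_def
    by (simp add: sum_subtractf sum.distrib distrib_right)
qed

subsection \<open>Equilibrium conditions\<close>

text \<open>The trivial update on the right lets \<open>payoff_update\<close> expand both sides
  alike.\<close>

lemma nash_deviation:
  assumes "nash_equilibrium num v p p0 A b m" "mi \<in> message_space"
  shows "payoff num v p p0 A b (m(i := mi)) i \<le> payoff num v p p0 A b (m(i := m i)) i"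
  using assms by (simp add: nash_equilibrium_def)

context
  fixes num :: "'n::finite \<Rightarrow> nat"
    and v :: "'n \<Rightarrow> 't::finite \<Rightarrow> real \<Rightarrow> real"
    and p :: "real^'t" and p0 :: real
    and A :: "real^'t^'n^'l" and b :: "real^'l"
    and m :: "'n \<Rightarrow> ('t, 'l::finite) message"
  assumes N: "CARD('n) \<ge> 2" and num: "bij_betw num UNIV {..<CARD('n)}"
    and nash: "nash_equilibrium num v p p0 A b m"
begin

lemma nash_nonneg: "0 \<le> msg_q (m i) $ l" "0 \<le> msg_s (m i) $ t"
  using nash by (auto simp: nash_equilibrium_def message_space_def)

text \<open>A guess affects its author's payoff only through the quadratic penalty, so an error
  would be corrected. The predecessor's guess is the one that enters \<open>zeta\<close> and the
  constraint slack of \<open>i\<close>.\<close>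

lemma nash_beta: "msg_beta (m (prev_user num i)) = msg_y (m i)"
proof -
  let ?j = "prev_user num i"
  have "m ?j\<lparr>msg_beta := msg_y (m i)\<rparr> \<in> message_space"
    using nash_nonneg by (simp add: message_space_def)
  from nash_deviation[OF nash this, of ?j]
  have "(\<Sum>t\<in>UNIV. (msg_beta (m ?j) $ t - msg_y (m i) $ t)\<^sup>2) \<le> 0"
    unfolding payoff_update[OF N num] by (simp add: next_prev_user[OF N num])
  then have "(\<Sum>t\<in>UNIV. (msg_beta (m ?j) $ t - msg_y (m i) $ t)\<^sup>2) = 0"
    by (simp add: antisym sum_nonneg)
  then show ?thesis by (simp add: sum_nonneg_eq_0_iff vec_eq_iff)
qed

lemma nash_zeta: "zeta num m i = (\<Sum>j\<in>UNIV. msg_y (m j))"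
  by (simp add: zeta_def nash_beta sum_diff1)

text \<open>Makes the slack the same for all users, as \<open>penalty_consensus\<close> requires of
  its \<open>g\<close>.\<close>

lemma nash_slack:
  "b $ l - (\<Sum>j\<in>UNIV - {i}. (A $ l $ j) \<bullet> msg_y (m j))
     - (A $ l $ i) \<bullet> msg_beta (m (prev_user num i))
   = b $ l - (\<Sum>j\<in>UNIV. (A $ l $ j) \<bullet> msg_y (m j))"
  by (simp add: nash_beta sum_diff1)

lemma nash_q_optimal:
  assumes "0 \<le> c"
  shows "(msg_q (m i) $ l - q_others m i $ l)\<^sup>2
        + msg_q (m i) $ l * (b $ l - (\<Sum>j\<in>UNIV. (A $ l $ j) \<bullet> msg_y (m j)))
      \<le> (c - q_others m i $ l)\<^sup>2 + c * (b $ l - (\<Sum>j\<in>UNIV. (A $ l $ j) \<bullet> msg_y (m j)))"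
proof -
  have dev: "m i\<lparr>msg_q := \<chi> k. if k = l then c else msg_q (m i) $ k\<rparr> \<in> message_space"
    using nash_nonneg assms by (simp add: message_space_def)
  show ?thesis
    using nash_deviation[OF nash dev, of i]
      sum_update_coordinate[of "\<lambda>k z. (z - q_others m i $ k)\<^sup>2
        + z * (b $ k - (\<Sum>j\<in>UNIV. (A $ k $ j) \<bullet> msg_y (m j)))" l c "msg_q (m i)"]
    unfolding payoff_update[OF N num] nash_slack
    \<comment> \<open>The updated vector must keep the form that
      \<open>sum_update_coordinate\<close> rewrites, hence the disabled rule.\<close>
    by (simp del: vec_lambda_beta)
qed

lemma nash_s_optimal:
  assumes "0 \<le> c"
  shows "(msg_s (m i) $ t - s_others m i $ t)\<^sup>2
        + msg_s (m i) $ t * (zeta_peak num m i - zeta num m i $ t)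
      \<le> (c - s_others m i $ t)\<^sup>2 + c * (zeta_peak num m i - zeta num m i $ t)"
proof -
  have dev: "m i\<lparr>msg_s := \<chi> k. if k = t then c else msg_s (m i) $ k\<rparr> \<in> message_space"
    using nash_nonneg assms by (simp add: message_space_def)
  show ?thesis
    using nash_deviation[OF nash dev, of i]
      sum_update_coordinate[of "\<lambda>k z. (z - s_others m i $ k)\<^sup>2
        + z * (zeta_peak num m i - zeta num m i $ k)" t c "msg_s (m i)"]
    unfolding payoff_update[OF N num]
    by (simp del: vec_lambda_beta)
qed

text \<open>The message space leaves \<open>y\<close> unrestricted and the unit price does not react
  to it, so each demand is a maximizer over the whole real line.\<close>

lemma nash_y_optimal:
  "v i t c - unit_price num p p0 A m i t * c
   \<le> v i t (msg_y (m i) $ t) - unit_price num p p0 A m i t * msg_y (m i) $ t"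
proof -
  have dev: "m i\<lparr>msg_y := \<chi> k. if k = t then c else msg_y (m i) $ k\<rparr> \<in> message_space"
    using nash_nonneg by (simp add: message_space_def)
  show ?thesis
    using nash_deviation[OF nash dev, of i]
      sum_update_coordinate[of "\<lambda>k z. v i k z - unit_price num p p0 A m i k * z" t c
        "msg_y (m i)"]
    unfolding payoff_update[OF N num]
    by (simp del: vec_lambda_beta)
qed

text \<open>
  In the KKT conditions of the centralized problem, \<open>q\<close> is the multiplier of \<open>A x \<le> b\<close> and
  \<open>\<mu>\<close> that of the peak constraints.
\<close>

lemma nash_multipliers:
  assumes p0: "p0 \<ge> 0"
  obtains q :: "real^'l" and \<mu> :: "'t \<Rightarrow> real" and w :: real
  where "\<And>l. 0 \<le> q $ l" and "\<And>t. 0 \<le> \<mu> t" and "(\<Sum>t\<in>UNIV. \<mu> t) = p0"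
    and "centralized_feasible A b (allocation m, w)"
    and "\<And>l. q $ l * (b $ l - (\<Sum>i\<in>UNIV. (A $ l $ i) \<bullet> (allocation m $ i))) = 0"
    and "\<And>t. \<mu> t * (w - (\<Sum>i\<in>UNIV. allocation m $ i $ t)) = 0"
    and "\<And>i t. unit_price num p p0 A m i t
           = p $ t + \<mu> t + (\<Sum>l\<in>UNIV. q $ l * A $ l $ i $ t)"
proof -
  \<comment> \<open>An arbitrary reference user; by consensus any user's prices serve as
    multipliers.\<close>
  define k :: 'n where "k = undefined"
  define Y where "Y = (\<Sum>j\<in>UNIV. msg_y (m j))"
  \<comment> \<open>The smallest peak level compatible with the total demand
    \<open>Y\<close>.\<close>
  define w where "w = Max (range (($) Y))"
  have peak: "zeta_peak num m i = w" for i
    unfolding zeta_peak_def nash_zeta w_def Y_def by simp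
  have Yt: "(\<Sum>i\<in>UNIV. allocation m $ i $ t) = Y $ t" for t
    by (simp add: Y_def allocation_def)
  have w: "Y $ t \<le> w" for t by (simp add: w_def)
  note q = penalty_consensus[where f = "\<lambda>i. msg_q (m i)", OF N nash_nonneg(1)
      nash_q_optimal[unfolded q_others_def]]
  note s = penalty_consensus[where f = "\<lambda>i. msg_s (m i)", OF N nash_nonneg(2)
      nash_s_optimal[unfolded s_others_def peak nash_zeta, folded Y_def]]
  have q_eq: "q_others m i = msg_q (m k)" for i
    unfolding vec_eq_iff q_others_def using q(1,2) by metis
  have s_eq: "s_others m i = msg_s (m k)" for i
    unfolding vec_eq_iff s_others_def using s(1,2) by metis
  note r = radial_price_peak[where s = "msg_s (m k)" and y = Y,
      OF nash_nonneg(2) s(4)[unfolded w_def] p0]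
  show ?thesis
  proof
    show "0 \<le> msg_q (m k) $ l" for l by (rule nash_nonneg)
    show "0 \<le> radial_price p0 (msg_s (m k)) Y t" for t by (rule r(1))
    show "(\<Sum>t\<in>UNIV. radial_price p0 (msg_s (m k)) Y t) = p0" by (rule r(2))
    show "centralized_feasible A b (allocation m, w)"
      using q(3) w by (auto simp: centralized_feasible_def feasible_set_def Yt)
        (simp add: allocation_def)
    show "msg_q (m k) $ l * (b $ l - (\<Sum>i\<in>UNIV. (A $ l $ i) \<bullet> (allocation m $ i))) = 0" for l
      using q(4)[of k l] by (simp add: allocation_def)
    show "radial_price p0 (msg_s (m k)) Y t * (w - (\<Sum>i\<in>UNIV. allocation m $ i $ t)) = 0" for t
      using r(3)[of t] by (simp add: Yt w_def)
    show "unit_price num p p0 A m i t = p $ t + radial_price p0 (msg_s (m k)) Y t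
        + (\<Sum>l\<in>UNIV. msg_q (m k) $ l * A $ l $ i $ t)" for i t
      unfolding unit_price_def q_eq s_eq nash_zeta Y_def ..
  qed
qed

end

subsection \<open>Lagrangian duality\<close>

text \<open>\<open>K\<close> collects all prices linear in \<open>x\<close>. Since
  \<open>\<mu>\<close> sums to \<open>p0\<close>, the term \<open>p0 * w\<close> is absorbed into
  the peak slack, which leaves the first two sums free of \<open>w\<close>.\<close>

lemma objective_eq_lagrangian:
  fixes A :: "real^'t^'n^'l"
  assumes "(\<Sum>t\<in>UNIV. \<mu> t) = p0"
    and K: "\<And>i t. K i t = p $ t + \<mu> t + (\<Sum>l\<in>UNIV. q $ l * A $ l $ i $ t)"
  shows "centralized_objective v p p0 (x, w) =
      (\<Sum>i\<in>UNIV. \<Sum>t\<in>UNIV. v i t (x $ i $ t) - K i t * x $ i $ t)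
      + (\<Sum>l\<in>UNIV. q $ l * b $ l)
      - (\<Sum>l\<in>UNIV. q $ l * (b $ l - (\<Sum>i\<in>UNIV. (A $ l $ i) \<bullet> (x $ i))))
      - (\<Sum>t\<in>UNIV. \<mu> t * (w - (\<Sum>i\<in>UNIV. x $ i $ t)))"
proof -
  have "(\<Sum>i\<in>UNIV. \<Sum>t\<in>UNIV. K i t * x $ i $ t)
      = (\<Sum>i\<in>UNIV. \<Sum>t\<in>UNIV. p $ t * x $ i $ t) + (\<Sum>i\<in>UNIV. \<Sum>t\<in>UNIV. \<mu> t * x $ i $ t)
        + (\<Sum>i\<in>UNIV. \<Sum>t\<in>UNIV. \<Sum>l\<in>UNIV. q $ l * A $ l $ i $ t * x $ i $ t)"
    by (simp add: K distrib_right sum.distrib sum_distrib_right)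
  also have "(\<Sum>i\<in>UNIV. \<Sum>t\<in>UNIV. \<Sum>l\<in>UNIV. q $ l * A $ l $ i $ t * x $ i $ t)
      = (\<Sum>i\<in>UNIV. \<Sum>l\<in>UNIV. q $ l * ((A $ l $ i) \<bullet> (x $ i)))"
    by (subst sum.swap) (simp add: inner_vec_def sum_distrib_left mult.assoc)
  also have "\<dots> = (\<Sum>l\<in>UNIV. q $ l * (\<Sum>i\<in>UNIV. (A $ l $ i) \<bullet> (x $ i)))"
    by (subst sum.swap) (simp add: sum_distrib_left)
  also have "(\<Sum>i\<in>UNIV. \<Sum>t\<in>UNIV. p $ t * x $ i $ t) = (\<Sum>t\<in>UNIV. p $ t * (\<Sum>i\<in>UNIV. x $ i $ t))"
    by (subst sum.swap) (simp add: sum_distrib_left)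
  also have "(\<Sum>i\<in>UNIV. \<Sum>t\<in>UNIV. \<mu> t * x $ i $ t) = (\<Sum>t\<in>UNIV. \<mu> t * (\<Sum>i\<in>UNIV. x $ i $ t))"
    by (subst sum.swap) (simp add: sum_distrib_left)
  finally show ?thesis
    unfolding centralized_objective_def utility_def
    by (simp add: sum_subtractf right_diff_distrib assms(1) flip: sum_distrib_right)
qed

text \<open>The slack terms are nonnegative at feasible points and vanish at \<open>(y, w)\<close>;
  what remains is separable and maximized coordinatewise by \<open>y\<close>.\<close>

lemma saddle_point_optimal:
  fixes A :: "real^'t^'n^'l"
  assumes q: "\<And>l. 0 \<le> q $ l" and \<mu>: "\<And>t. 0 \<le> \<mu> t" "(\<Sum>t\<in>UNIV. \<mu> t) = p0"
    and feas: "centralized_feasible A b (y, w)"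
    and slack: "\<And>l. q $ l * (b $ l - (\<Sum>i\<in>UNIV. (A $ l $ i) \<bullet> (y $ i))) = 0"
      "\<And>t. \<mu> t * (w - (\<Sum>i\<in>UNIV. y $ i $ t)) = 0"
    and K: "\<And>i t. K i t = p $ t + \<mu> t + (\<Sum>l\<in>UNIV. q $ l * A $ l $ i $ t)"
    and conc: "\<And>i t. strictly_concave (v i t)"
    and max: "\<And>i t c. v i t c - K i t * c \<le> v i t (y $ i $ t) - K i t * y $ i $ t"
  shows "centralized_optimal v p p0 A b (y, w)"
    and "centralized_optimal v p p0 A b (x, w') \<Longrightarrow> y = x"
proof -
  define \<Phi> where "\<Phi> x = (\<Sum>i\<in>UNIV. \<Sum>t\<in>UNIV. v i t (x $ i $ t) - K i t * x $ i $ t)"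
    for x :: "real^'t^'n"
  define B where "B = (\<Sum>l\<in>UNIV. q $ l * b $ l)"
  note obj = objective_eq_lagrangian[OF \<mu>(2) K, of v _ _ b, folded \<Phi>_def B_def]
  have upper: "centralized_objective v p p0 (x, w) \<le> \<Phi> x + B"
    if "centralized_feasible A b (x, w)" for x w
  proof -
    have "0 \<le> (\<Sum>l\<in>UNIV. q $ l * (b $ l - (\<Sum>i\<in>UNIV. (A $ l $ i) \<bullet> (x $ i))))"
      "0 \<le> (\<Sum>t\<in>UNIV. \<mu> t * (w - (\<Sum>i\<in>UNIV. x $ i $ t)))"
      using that q \<mu>(1)
      by (auto simp: centralized_feasible_def feasible_set_def intro!: sum_nonneg mult_nonneg_nonneg)
    then show ?thesis unfolding obj by linarith
  qed
  have tight: "centralized_objective v p p0 (y, w) = \<Phi> y + B"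
    unfolding obj slack by simp
  have "\<Phi> x \<le> \<Phi> y" for x unfolding \<Phi>_def by (intro sum_mono max)
  then show "centralized_optimal v p p0 A b (y, w)"
    using upper tight feas unfolding centralized_optimal_def is_arg_max_linorder
    by (smt (verit) surj_pair)
  assume opt: "centralized_optimal v p p0 A b (x, w')"
  show "y = x"
  proof (rule ccontr)
    assume "y \<noteq> x"
    then obtain i t where ne: "x $ i $ t \<noteq> y $ i $ t" by (metis vec_eq_iff)
    \<comment> \<open>One differing slot makes the share of user \<open>i\<close> strictly smaller;
      no other slot or user can make up for it.\<close>
    have "(\<Sum>t\<in>UNIV. v i t (x $ i $ t) - K i t * x $ i $ t)
        < (\<Sum>t\<in>UNIV. v i t (y $ i $ t) - K i t * y $ i $ t)"
      using strictly_concave_strict_max[OF conc max ne] max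
      by (intro sum_strict_mono_ex1) auto
    then have "\<Phi> x < \<Phi> y"
      unfolding \<Phi>_def using max by (intro sum_strict_mono_ex1) (auto intro: sum_mono)
    moreover have "centralized_objective v p p0 (x, w') \<le> \<Phi> x + B"
      using opt upper by (simp add: centralized_optimal_def is_arg_max_def)
    moreover have "centralized_objective v p p0 (y, w) \<le> centralized_objective v p p0 (x, w')"
      using opt feas unfolding centralized_optimal_def is_arg_max_linorder by blast
    ultimately show False using tight by linarith
  qed
qed

text \<open>The first conjunct supplies an optimal solution, so that the uniqueness in the second is
  not vacuous; \<open>w\<close> is existential because an allocation records demands only.\<close>

theorem theorem1:
  fixes num :: "'n::finite \<Rightarrow> nat"
    and v :: "'n \<Rightarrow> 't::finite \<Rightarrow> real \<Rightarrow> real"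
    and p :: "real^'t" and p0 :: real
    and A :: "real^'t^'n^'l" and b :: "real^'l"
    and m :: "'n \<Rightarrow> ('t, 'l::finite) message"
  assumes "CARD('n) \<ge> 2"
    and "bij_betw num UNIV {..<CARD('n)}"
    and "p0 \<ge> 0"
    and "\<And>i t. twice_differentiable (v i t)"
    and "\<And>i t. strictly_concave (v i t)"
    and "\<And>l. b $ l \<ge> 0"
    and "polytope (feasible_set A b)"
    and "coordinate_convex (feasible_set A b)"
    and "nash_equilibrium num v p p0 A b m"
  shows "(\<exists>w. centralized_optimal v p p0 A b (allocation m, w)) \<and>
         (\<forall>x w. centralized_optimal v p p0 A b (x, w) \<longrightarrow> allocation m = x)"
proof -
  obtain q \<mu> w where kkt:
    "\<And>l. 0 \<le> q $ l" "\<And>t. 0 \<le> \<mu> t" "(\<Sum>t\<in>UNIV. \<mu> t) = p0"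
    "centralized_feasible A b (allocation m, w)"
    "\<And>l. q $ l * (b $ l - (\<Sum>i\<in>UNIV. (A $ l $ i) \<bullet> (allocation m $ i))) = 0"
    "\<And>t. \<mu> t * (w - (\<Sum>i\<in>UNIV. allocation m $ i $ t)) = 0"
    "\<And>i t. unit_price num p p0 A m i t = p $ t + \<mu> t + (\<Sum>l\<in>UNIV. q $ l * A $ l $ i $ t)"
    using nash_multipliers[OF assms(1,2,9,3)] by blast
  have max: "v i t c - unit_price num p p0 A m i t * c
      \<le> v i t (allocation m $ i $ t) - unit_price num p p0 A m i t * allocation m $ i $ t" for i t c
    using nash_y_optimal[OF assms(1,2,9)] by (simp add: allocation_def)
  show ?thesis
    using saddle_point_optimal[OF kkt assms(5) max] by blast
qed

end
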